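(* Let $Q_+^4$ be the Cayley graph of $\mathbb{Z}_2^4$ with generating set $\{e_1,e_2,e_3,e_4,e_1+e_2+e_3+e_4\}$, where $e_i$ is the vector of Hamming weight $1$ with a $1$ in its $i$th coordinate. Then $Q_+^4$ is a $5$-regular graph which admits an orthogonal signing, and it is not isomorphic to any graph obtained from a $4$-regular graph $H$ admitting an orthogonal signing by taking two vertex-disjoint copies of $H$ and adding the perfect matching that joins each vertex of the first copy to its copy in the second.
   Context: For $S \subseteq \mathbb{Z}_2^n$, the Cayley graph of $\mathbb{Z}_2^n$ with generating set $S$ has vertex set $\mathbb{Z}_2^n$ and edge set consisting of all unordered pairs $\{g,g+s\}$ with $g\in\mathbb{Z}_2^n$, $s\in S$. An orthogonal signing of a graph is a real symmetric matrix obtained from the adjacency matrix of the graph by replacing each nonzero entry by $+1$ or $-1$, so that any two distinct rows are orthogonal. *)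

theory Defs
  imports "HOL-Analysis.Finite_Cartesian_Product" "HOL-Library.Z2"
begin

record 'a ugraph =
  vertices :: "'a set"
  edges :: "'a set set"

definition simple_graph :: "'a ugraph \<Rightarrow> bool" where
  "simple_graph G \<longleftrightarrow> finite (vertices G) \<and>
     (\<forall>e\<in>edges G. e \<subseteq> vertices G \<and> card e = 2)"

definition neighbours :: "'a ugraph \<Rightarrow> 'a \<Rightarrow> 'a set" where
  "neighbours G u = {v \<in> vertices G. {u, v} \<in> edges G}"

definition regular_graph :: "nat \<Rightarrow> 'a ugraph \<Rightarrow> bool" where
  "regular_graph d G \<longleftrightarrow> simple_graph G \<and> (\<forall>u\<in>vertices G. card (neighbours G u) = d)"

definition graph_isomorphic :: "'a ugraph \<Rightarrow> 'b ugraph \<Rightarrow> bool" where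
  "graph_isomorphic G H \<longleftrightarrow> (\<exists>f. bij_betw f (vertices G) (vertices H) \<and>
     (\<forall>u\<in>vertices G. \<forall>v\<in>vertices G. {u, v} \<in> edges G \<longleftrightarrow> {f u, f v} \<in> edges H))"

text \<open>Matrices are functions of two vertices; only the entries indexed by vertices of the
  graph are relevant.\<close>

definition adjacency_matrix :: "'a ugraph \<Rightarrow> 'a \<Rightarrow> 'a \<Rightarrow> real" where
  "adjacency_matrix G u v = (if {u, v} \<in> edges G then 1 else 0)"

definition orthogonal_signing :: "'a ugraph \<Rightarrow> ('a \<Rightarrow> 'a \<Rightarrow> real) \<Rightarrow> bool" where
  "orthogonal_signing G A \<longleftrightarrow>
     (\<forall>u\<in>vertices G. \<forall>v\<in>vertices G. A u v = A v u) \<and>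
     (\<forall>u\<in>vertices G. \<forall>v\<in>vertices G.
        if adjacency_matrix G u v = 0 then A u v = 0 else A u v \<in> {1, -1}) \<and>
     (\<forall>u\<in>vertices G. \<forall>v\<in>vertices G. u \<noteq> v \<longrightarrow> (\<Sum>w\<in>vertices G. A u w * A v w) = 0)"

definition admits_orthogonal_signing :: "'a ugraph \<Rightarrow> bool" where
  "admits_orthogonal_signing G \<longleftrightarrow> (\<exists>A. orthogonal_signing G A)"

definition cayley_graph :: "(bit ^ 'n) set \<Rightarrow> (bit ^ 'n) ugraph" where
  "cayley_graph S = \<lparr>vertices = UNIV, edges = {{g, g + s} |g s. s \<in> S}\<rparr>"

text \<open>The index type \<open>4\<close> is the ring of integers modulo 4, so its elements are
  \<open>1\<close>, \<open>2\<close>, \<open>3\<close> and \<open>4 = 0\<close>.\<close>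

definition unit_vec :: "4 \<Rightarrow> bit ^ 4" where
  "unit_vec i = axis i 1"

definition Q4_plus :: "(bit ^ 4) ugraph" where
  "Q4_plus = cayley_graph
     {unit_vec 1, unit_vec 2, unit_vec 3, unit_vec 4,
      unit_vec 1 + unit_vec 2 + unit_vec 3 + unit_vec 4}"

definition matched_double :: "'a ugraph \<Rightarrow> ('a + 'a) ugraph" where
  "matched_double H =
     \<lparr>vertices = vertices H <+> vertices H,
      edges = (\<lambda>e. Inl ` e) ` edges H \<union> (\<lambda>e. Inr ` e) ` edges H \<union>
        {{Inl v, Inr v} |v. v \<in> vertices H}\<rparr>"

end

(* Five pairwise anticommuting symmetric involutive signed permutation matrices, one for each
   generator, add up to an orthogonal signing.  A 4-regular graph H whose matched double has
   16 vertices has 8 vertices, hence two distinct nonadjacent vertices u, v; the first copy of u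
   and the second copy of v are then at distance at least 3, whereas the graph Q_+^4 has
   diameter 2. *)
theory Submission
  imports Defs "HOL-Analysis.Cartesian_Space"
begin

abbreviation generators :: "(bit ^ 4) set" where
  "generators \<equiv> {unit_vec 1, unit_vec 2, unit_vec 3, unit_vec 4,
      unit_vec 1 + unit_vec 2 + unit_vec 3 + unit_vec 4}"

lemma vec4_eq_iff: "x = y \<longleftrightarrow> x $ 1 = y $ 1 \<and> x $ 2 = y $ 2 \<and> x $ 3 = y $ 3 \<and> x $ 4 = y $ 4"
  for x y :: "'a ^ 4"
  unfolding vec_eq_iff by (rule forall_4)

lemma UNIV_bit: "UNIV = {0, 1 :: bit}"
  using bit_not_one_iff by blast

instance bit :: finite
  by standard (simp add: UNIV_bit)

text \<open>Every vector over the two-element field is its own negative, so addition doubles as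
  subtraction.\<close>

lemma bit_vec_add_eq_iff: "u + s = v \<longleftrightarrow> s = u + v" for u v s :: "bit ^ 'n"
proof -
  have "a + b = c \<longleftrightarrow> b = a + c" for a b c :: bit
    by (cases a; cases b; cases c) simp_all
  then show ?thesis
    by (simp add: vec_eq_iff)
qed

lemma bit_vec_add_cancel_left: "u + (u + v) = v" for u v :: "bit ^ 'n"
  by (metis bit_vec_add_eq_iff)

lemma unit_vec_nth: "unit_vec i $ j = (if j = i then 1 else 0)"
  by (simp add: unit_vec_def axis_def)

text \<open>In characteristic 2 the difference of two endpoints is symmetric in them, so an
  unordered edge determines its generator.\<close>

lemma cayley_graph_edge_iff: "{u, v} \<in> edges (cayley_graph S) \<longleftrightarrow> u + v \<in> S"
proof
  assume "{u, v} \<in> edges (cayley_graph S)"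
  then obtain g s where "{u, v} = {g, g + s}" "s \<in> S"
    by (auto simp: cayley_graph_def)
  then show "u + v \<in> S"
    by (metis add.commute bit_vec_add_eq_iff doubleton_eq_iff)
next
  assume "u + v \<in> S"
  moreover have "{u, v} = {u, u + (u + v)}"
    by (simp only: bit_vec_add_cancel_left)
  ultimately show "{u, v} \<in> edges (cayley_graph S)"
    unfolding cayley_graph_def by (simp only: ugraph.simps mem_Collect_eq) blast
qed

lemma vertices_cayley_graph [simp]: "vertices (cayley_graph S) = UNIV"
  by (simp add: cayley_graph_def)

lemma regular_graph_cayley_graph:
  assumes "0 \<notin> S"
  shows "regular_graph (card S) (cayley_graph S)"
proof -
  have "neighbours (cayley_graph S) u = (+) u ` S" for u
    by (auto simp only: neighbours_def cayley_graph_edge_iff image_iff vertices_cayley_graph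
        bit_vec_add_cancel_left mem_Collect_eq) (metis bit_vec_add_cancel_left)
  moreover have "s \<in> S \<Longrightarrow> g \<noteq> g + s" for g s
    using assms by (metis add.right_neutral add_left_cancel)
  ultimately show ?thesis
    by (auto simp: regular_graph_def simple_graph_def cayley_graph_def card_image)
qed

lemma Q4_plus_eq: "Q4_plus = cayley_graph generators"
  by (simp add: Q4_plus_def)

text \<open>Holds because the five generators are pairwise distinct; a constant \<open>f\<close>
  then counts them.\<close>

lemma sum_generators:
  "sum f generators = f (unit_vec 1) + f (unit_vec 2) + f (unit_vec 3) + f (unit_vec 4)
     + f (unit_vec 1 + unit_vec 2 + unit_vec 3 + unit_vec 4)"
  for f :: "_ \<Rightarrow> 'a::comm_monoid_add"
  by (simp add: vec4_eq_iff unit_vec_nth add.assoc)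

lemma card_generators: "card generators = 5"
  using sum_generators[of "\<lambda>_. 1 :: nat"] by simp

text \<open>Weights 1 and 4 are the generators, weight 2 is a sum of two unit vectors, and weight 3
  is the all-ones vector plus a unit vector. Hence the diameter is at most 2.\<close>

lemma vec4_dist_le_2:
  obtains "x = 0" | "x \<in> generators" | s t where "s \<in> generators" "t \<in> generators" "x = s + t"
proof -
  have "x = 0 \<or> x \<in> generators \<or> (\<exists>s\<in>generators. x + s \<in> generators)"
    by (cases "x $ 1"; cases "x $ 2"; cases "x $ 3"; cases "x $ 4")
      (simp_all add: vec4_eq_iff unit_vec_nth)
  then show thesis
    using that by (metis add.commute bit_vec_add_cancel_left)
qed

lemma regular_Q4_plus: "regular_graph 5 Q4_plus"
proof -
  have "0 \<notin> generators"
    by (simp add: vec4_eq_iff unit_vec_nth)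
  then show ?thesis
    using regular_graph_cayley_graph card_generators Q4_plus_eq by metis
qed

definition sgn_bit :: "bit \<Rightarrow> real" where
  "sgn_bit b = (if b = 0 then 1 else -1)"

text \<open>The first four blocks are signed permutation matrices that square to the identity and pairwise
  anticommute. The block of the last generator is their product, which is again a symmetric
  involution and anticommutes with each factor; its exponent \<open>u\<^sub>1 + u\<^sub>3\<close> is
  \<open>3 u\<^sub>1 + 2 u\<^sub>2 + u\<^sub>3\<close> modulo 2.\<close>

definition Q4_plus_signing :: "bit ^ 4 \<Rightarrow> bit ^ 4 \<Rightarrow> real" where
  "Q4_plus_signing u v =
     (if u + v = unit_vec 1 then 1
      else if u + v = unit_vec 2 then sgn_bit (u $ 1)
      else if u + v = unit_vec 3 then sgn_bit (u $ 1 + u $ 2)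
      else if u + v = unit_vec 4 then sgn_bit (u $ 1 + u $ 2 + u $ 3)
      else if u + v = unit_vec 1 + unit_vec 2 + unit_vec 3 + unit_vec 4
        then sgn_bit (u $ 1 + u $ 3)
      else 0)"

text \<open>The exponent attached to a generator \<open>s\<close> is a linear form in
  \<open>u\<close> that vanishes at \<open>s\<close>, so passing from \<open>u\<close> to
  \<open>u + s\<close> keeps the sign.\<close>

lemma Q4_plus_signing_commute: "Q4_plus_signing u v = Q4_plus_signing v u"
  by (cases "u $ 1"; cases "u $ 2"; cases "u $ 3"; cases "u $ 4";
      cases "v $ 1"; cases "v $ 2"; cases "v $ 3"; cases "v $ 4")
    (simp_all add: Q4_plus_signing_def vec4_eq_iff unit_vec_nth sgn_bit_def)

text \<open>A common neighbour \<open>u + s = v + t\<close> is paired with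
  \<open>u + t = v + s\<close>; since the blocks of \<open>s\<close> and \<open>t\<close>
  anticommute, the two products cancel.\<close>

lemma Q4_plus_signing_orthogonal:
  assumes "u \<noteq> v"
  shows "(\<Sum>w\<in>UNIV. Q4_plus_signing u w * Q4_plus_signing v w) = 0"
proof -
  \<comment> \<open>Only the five neighbours of \<open>u\<close> contribute, which leaves a finite
    check over all pairs of vertices.\<close>
  have "(\<Sum>w\<in>UNIV. Q4_plus_signing u w * Q4_plus_signing v w) = (\<Sum>w\<in>(+) u ` generators. Q4_plus_signing u w * Q4_plus_signing v w)"
  proof (rule sum.mono_neutral_right)
    show "\<forall>w\<in>UNIV - (+) u ` generators. Q4_plus_signing u w * Q4_plus_signing v w = 0"
      unfolding Q4_plus_signing_def image_iff bit_vec_add_eq_iff by (auto; metis bit_vec_add_eq_iff)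
  qed auto
  also have "\<dots> = (\<Sum>s\<in>generators. Q4_plus_signing u (u + s) * Q4_plus_signing v (u + s))"
    by (subst sum.reindex) (simp_all add: inj_on_def o_def)
  also have "\<dots> = 0"
    unfolding sum_generators using assms
    by (cases "u $ 1"; cases "u $ 2"; cases "u $ 3"; cases "u $ 4";
        cases "v $ 1"; cases "v $ 2"; cases "v $ 3"; cases "v $ 4")
      (simp_all add: Q4_plus_signing_def vec4_eq_iff unit_vec_nth sgn_bit_def)
  finally show ?thesis .
qed

lemma Q4_plus_orthogonal_signing: "orthogonal_signing Q4_plus Q4_plus_signing"
  unfolding orthogonal_signing_def
proof (intro conjI ballI impI)
  show "if adjacency_matrix Q4_plus u v = 0 then Q4_plus_signing u v = 0 else Q4_plus_signing u v \<in> {1, - 1}" for u v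
    by (auto simp: adjacency_matrix_def Q4_plus_eq cayley_graph_edge_iff Q4_plus_signing_def sgn_bit_def)
qed (auto simp: Q4_plus_signing_commute Q4_plus_signing_orthogonal Q4_plus_eq)

lemma matched_double_edge_iff:
  fixes H :: "'a ugraph"
  shows
  "{Inl u, Inl v} \<in> edges (matched_double H) \<longleftrightarrow> {u, v} \<in> edges H"
  "{Inr u, Inr v} \<in> edges (matched_double H) \<longleftrightarrow> {u, v} \<in> edges H"
  "{Inl u, Inr v} \<in> edges (matched_double H) \<longleftrightarrow> u = v \<and> u \<in> vertices H"
proof -
  have Inl: "Inl ` e = {Inl a, Inl b :: 'a + 'a} \<longleftrightarrow> e = {a, b}" for e :: "'a set" and a b
    using inj_image_eq_iff[of "Inl :: 'a \<Rightarrow> 'a + 'a" e "{a, b}"] by simp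
  have Inr: "Inr ` e = {Inr a, Inr b :: 'a + 'a} \<longleftrightarrow> e = {a, b}" for e :: "'a set" and a b
    using inj_image_eq_iff[of "Inr :: 'a \<Rightarrow> 'a + 'a" e "{a, b}"] by simp
  have mixed: "Inl ` e \<noteq> insert (Inr a) B" "Inr ` e \<noteq> insert (Inl a) B"
    "Inl ` e \<noteq> {x, Inr a}" "Inr ` e \<noteq> {x, Inl a}"
    for e :: "'a set" and a :: 'a and B and x :: "'a + 'a"
    by blast+
  show "{Inl u, Inl v} \<in> edges (matched_double H) \<longleftrightarrow> {u, v} \<in> edges H"
    "{Inr u, Inr v} \<in> edges (matched_double H) \<longleftrightarrow> {u, v} \<in> edges H"
    "{Inl u, Inr v} \<in> edges (matched_double H) \<longleftrightarrow> u = v \<and> u \<in> vertices H"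
    by (auto simp: matched_double_def image_iff doubleton_eq_iff mixed mixed[symmetric]
        Inl Inr eq_commute[of "{_, _}" "_ ` _"])
qed

lemma Q4_plus_not_isomorphic_matched_double:
  assumes "regular_graph 4 H"
  shows "\<not> graph_isomorphic Q4_plus (matched_double H)"
proof
  assume "graph_isomorphic Q4_plus (matched_double H)"
  then obtain f where bij: "bij_betw f UNIV (vertices H <+> vertices H)"
    and edge: "\<And>x y. x + y \<in> generators \<longleftrightarrow> {f x, f y} \<in> edges (matched_double H)"
    by (auto simp: graph_isomorphic_def Q4_plus_eq cayley_graph_edge_iff matched_double_def)
  have fin: "finite (vertices H)"
    using assms by (simp add: regular_graph_def simple_graph_def)
  have "CARD(bit) = 2"
    by (simp add: UNIV_bit)
  then have "CARD(bit ^ 4) = 16"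
    by simp
  then have card: "card (vertices H) = 8"
    using bij_betw_same_card[OF bij] fin by (simp add: card_Plus)
  then obtain u where u: "u \<in> vertices H"
    by fastforce
  \<comment> \<open>A closed neighbourhood has at most 5 of the 8 vertices, so some \<open>v\<close>
    lies outside it.\<close>
  have "card (insert u (neighbours H u)) \<le> 5"
    using assms u card_insert_le_m1[of 5 "neighbours H u" u] by (simp add: regular_graph_def)
  then have "\<not> vertices H \<subseteq> insert u (neighbours H u)"
    using card fin card_mono[of "insert u (neighbours H u)" "vertices H"]
    by (fastforce simp: neighbours_def)
  then obtain v where v: "v \<in> vertices H" "v \<noteq> u" "{u, v} \<notin> edges H"
    by (auto simp: neighbours_def)
  obtain x y where x: "f x = Inl u" and y: "f y = Inr v"
    using bij u v(1) unfolding bij_betw_def by (metis InlI InrI imageE)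
  consider "x + y = 0" | "x + y \<in> generators"
    | s t where "s \<in> generators" "t \<in> generators" "x + y = s + t"
    by (rule vec4_dist_le_2)
  then show False
  proof cases
    case 1
    then have "x = y"
      by (metis add.right_neutral bit_vec_add_eq_iff)
    then show False
      using x y by simp
  next
    case 2
    then show False
      using edge[of x y] v x y by (simp add: matched_double_edge_iff)
  next
    case 3
    \<comment> \<open>The midpoint of a path of length 2 from \<open>x\<close> to
      \<open>y\<close>.\<close>
    define w where "w = x + s"
    have "x + w = s" "w + y = t"
      using 3 unfolding w_def by (metis add.commute add.left_commute bit_vec_add_eq_iff)+
    with 3 have "{f x, f w} \<in> edges (matched_double H)" "{f w, f y} \<in> edges (matched_double H)"
      using edge by blast+
    \<comment> \<open>In the first copy \<open>f w\<close> must be \<open>Inl v\<close>, in the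
      second \<open>Inr u\<close>; either way \<open>u\<close> and \<open>v\<close> would be
      adjacent in \<open>H\<close>.\<close>
    then show False
      using v x y
      by (cases "f w") (auto simp: matched_double_edge_iff insert_commute)
  qed
qed

theorem mainTheorem4:
  shows "regular_graph 5 Q4_plus \<and>
    admits_orthogonal_signing Q4_plus \<and>
    (\<forall>H :: 'a ugraph. regular_graph 4 H \<and> admits_orthogonal_signing H \<longrightarrow>
       \<not> graph_isomorphic Q4_plus (matched_double H))"
  using regular_Q4_plus Q4_plus_orthogonal_signing Q4_plus_not_isomorphic_matched_double
  unfolding admits_orthogonal_signing_def by blast

end
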